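(* Let $n\geq 2$ be an integer, let $x_1,\dots,x_n>0$ be real numbers, and let $L:\mathbb{R}\to\mathbb{R}$, $L(p)=\dfrac{\sum_{i=1}^n x_i^p}{\sum_{i=1}^n x_i^{p-1}}$, be the Lehmer mean function. Put $J=\dfrac{n(n+4)(n-1)}{6}-1$. Then $L$ has at most $J$ inflection points; moreover, if $J$ is even, then $L$ has at most $J-1$ inflection points.
   Context: A point $p^\star\in\mathbb{R}$ is an inflection point of the smooth function $L$ if $L''$ changes sign at $p^\star$, i.e. $L$ changes from strictly convex to strictly concave, or from strictly concave to strictly convex, at $p^\star$. *)

theory Defs
  imports "HOL-Analysis.Analysis"
begin

definition lehmer_mean :: "nat \<Rightarrow> (nat \<Rightarrow> real) \<Rightarrow> real \<Rightarrow> real" where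
  "lehmer_mean n x p = (\<Sum>i=1..n. x i powr p) / (\<Sum>i=1..n. x i powr (p - 1))"

(* Intended for smooth f: the second derivative has opposite strict signs on a
   left and on a right punctured neighbourhood of p. *)
definition inflection_point :: "(real \<Rightarrow> real) \<Rightarrow> real \<Rightarrow> bool" where
  "inflection_point f p \<longleftrightarrow>
     ((\<forall>\<^sub>F q in at_left p. deriv (deriv f) q > 0) \<and> (\<forall>\<^sub>F q in at_right p. deriv (deriv f) q < 0)) \<or>
     ((\<forall>\<^sub>F q in at_left p. deriv (deriv f) q < 0) \<and> (\<forall>\<^sub>F q in at_right p. deriv (deriv f) q > 0))"

(* The division is exact and, for n at least 2, so is the subtraction; see real_inflection_bound. *)
definition inflection_bound :: "nat \<Rightarrow> nat" where
  "inflection_bound n = n * (n + 4) * (n - 1) div 6 - 1"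

lemma six_dvd_inflection_bound: "6 dvd n * (n + 4) * (n - 1)" for n :: nat
proof (induction n)
  case (Suc n)
  have "even (n * (n + 3))" by simp
  then obtain k where k: "n * (n + 3) = 2 * k" by (rule evenE)
  show ?case
  proof (cases n)
    case (Suc m)
    have "Suc n * (Suc n + 4) * (Suc n - 1) = n * (n + 4) * (n - 1) + (3 * (n * (n + 3)))"
      unfolding Suc by (simp add: algebra_simps)
    also have "\<dots> = n * (n + 4) * (n - 1) + 6 * k" using k by simp
    finally show ?thesis using Suc.IH by simp
  qed simp
qed simp

lemma real_inflection_bound:
  assumes "n \<ge> 2"
  shows "real (inflection_bound n) = real n * (real n + 4) * (real n - 1) / 6 - 1"
proof -
  let ?m = "n * (n + 4) * (n - 1)"
  have "2 * 6 * 1 \<le> ?m" using assms by (intro mult_le_mono) auto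
  then have "1 \<le> ?m div 6" by linarith
  then have "real (inflection_bound n) = real (?m div 6) - 1"
    unfolding inflection_bound_def by linarith
  also have "real (?m div 6) = real ?m / 6"
    using real_of_nat_div[OF six_dvd_inflection_bound[of n]] by simp
  finally show ?thesis using assms by (simp add: of_nat_diff)
qed

end

theory Submission imports Defs begin

text \<open>
  With \<open>a i = ln (x i)\<close>, the second derivative of the Lehmer mean has the sign of an
  exponential sum over triples \<open>(i, j, k)\<close> of indices with exponents \<open>a i + a j + a k\<close>, whose
  coefficients vanish on the diagonal. It has at most \<open>n (n - 1) + (n choose 3)\<close> distinct
  exponents, so by Rolle's theorem it has at most one zero less than that, or vanishes identically.
  Its dominating coefficients at the two ends have opposite signs, so the number of sign changes
  is odd, which yields the improvement for even bounds.
\<close>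

section \<open>Zeros of exponential sums\<close>

text \<open>The zeros are added in increasing order, and Rolle's theorem is applied between the old
  maximum and the new point. The bound \<open>w < Max Z\<close> keeps the new zero of
  \<open>f'\<close> distinct from those found before.\<close>

lemma Rolle_finite_zeros:
  fixes f f' :: "real \<Rightarrow> real"
  assumes deriv: "\<And>t. (f has_real_derivative f' t) (at t)"
    and "finite Z" "Z \<noteq> {}" "\<And>z. z \<in> Z \<Longrightarrow> f z = 0"
  shows "\<exists>W. finite W \<and> Suc (card W) = card Z \<and> (\<forall>w\<in>W. f' w = 0 \<and> w < Max Z)"
  using assms(2-)
proof (induction Z rule: finite_linorder_max_induct)
  case (insert b Z)
  show ?case
  proof (cases "Z = {}")
    case True
    then show ?thesis by (intro exI[of _ "{}"]) auto
  next
    case False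
    then obtain W where W: "finite W" "Suc (card W) = card Z" "\<forall>w\<in>W. f' w = 0 \<and> w < Max Z"
      using insert by auto
    have M: "Max Z \<in> Z" "Max Z < b"
      using insert False by auto
    have "\<exists>z>Max Z. z < b \<and> f' z = 0"
    proof -
      have "continuous_on {Max Z..b} f"
        by (meson deriv DERIV_continuous continuous_at_imp_continuous_on)
      moreover have "f (Max Z) = f b" using insert M by auto
      \<comment> \<open>\<open>Rolle_deriv\<close> speaks of the derivative as a linear map;
        evaluating that map at 1 turns its vanishing into \<open>f' z = 0\<close>.\<close>
      ultimately obtain z where "Max Z < z" "z < b" "(\<lambda>h. h * f' z) = (\<lambda>h. 0)"
        using Rolle_deriv[OF M(2), of f "\<lambda>z h. h * f' z"] deriv
        by (metis has_field_derivative_imp_has_derivative mult_commute_abs)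
      then show ?thesis by (metis mult_1)
    qed
    then obtain z where z: "Max Z < z" "z < b" "f' z = 0" by blast
    have "Max (insert b Z) = b"
      using insert by (intro Max_eqI) (auto intro: less_imp_le)
    moreover have "z \<notin> W" "b \<notin> Z" using W z insert by force+
    ultimately show ?thesis
      using W z M insert.hyps(1) by (intro exI[of _ "insert z W"]) force
  qed
qed auto

text \<open>Proves finiteness and the bound at once from finite subsets alone, since an infinite set
  has a subset with \<open>Suc m\<close> elements.\<close>

lemma finite_card_le_iff_subsets:
  "finite A \<and> card A \<le> m \<longleftrightarrow> (\<forall>B\<subseteq>A. finite B \<longrightarrow> card B \<le> m)"
proof (intro iffI allI impI)
  assume *: "\<forall>B\<subseteq>A. finite B \<longrightarrow> card B \<le> m"
  have "finite A"
  proof (rule ccontr)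
    assume "infinite A"
    then obtain B where "B \<subseteq> A" "finite B" "card B = Suc m"
      using infinite_arbitrarily_large by blast
    with * show False by auto
  qed
  with * show "finite A \<and> card A \<le> m" by auto
qed (meson card_mono order_trans)

lemma card_zeros_le_Suc_card_zeros_deriv:
  fixes f f' :: "real \<Rightarrow> real"
  assumes deriv: "\<And>t. (f has_real_derivative f' t) (at t)"
    and "finite {t. f' t = 0}" "card {t. f' t = 0} \<le> m"
  shows "finite {t. f t = 0} \<and> card {t. f t = 0} \<le> Suc m"
  unfolding finite_card_le_iff_subsets
proof (intro allI impI)
  fix Z assume Z: "Z \<subseteq> {t. f t = 0}" "finite Z"
  show "card Z \<le> Suc m"
  proof (cases "Z = {}")
    case False
    then obtain W where W: "finite W" "Suc (card W) = card Z" "\<forall>w\<in>W. f' w = 0 \<and> w < Max Z"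
      using Rolle_finite_zeros[OF deriv Z(2)] Z(1) by blast
    then have "card W \<le> card {t. f' t = 0}"
      by (intro card_mono assms) auto
    with W assms show ?thesis by simp
  qed auto
qed

text \<open>Indexing by an arbitrary set, not by the exponents, allows equal exponents and zero
  coefficients, as they occur for sums over triples.\<close>

definition exp_sum :: "'a set \<Rightarrow> ('a \<Rightarrow> real) \<Rightarrow> ('a \<Rightarrow> real) \<Rightarrow> real \<Rightarrow> real" where
  "exp_sum S b c t = (\<Sum>s\<in>S. c s * exp (b s * t))"

lemma exp_sum_has_derivative:
  "(exp_sum S b c has_real_derivative exp_sum S b (\<lambda>s. c s * b s) t) (at t)"
  unfolding exp_sum_def by (auto intro!: derivative_eq_intros sum.cong simp: mult_ac)

lemma isCont_exp_sum: "isCont (exp_sum S b c) t"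
  using exp_sum_has_derivative DERIV_isCont by blast

text \<open>The factor is positive, so exponents can be translated without affecting zeros or
  signs.\<close>

lemma exp_sum_shift: "exp (- r * t) * exp_sum S b c t = exp_sum S (\<lambda>s. b s - r) c t"
  by (simp add: exp_sum_def sum_distrib_left left_diff_distrib exp_diff exp_minus field_simps)

text \<open>Shifting the exponents by \<open>b s\<close> makes the term of \<open>s\<close>
  constant, so differentiation removes it. The induction hypothesis bounds the zeros of the
  derivative, and Rolle's theorem adds at most one.\<close>

lemma exp_sum_zeros:
  assumes "finite S" "exp_sum S b c t0 \<noteq> 0"
  shows "finite {t. exp_sum S b c t = 0} \<and> card {t. exp_sum S b c t = 0} \<le> card S - 1"
  using assms
proof (induction S arbitrary: b c t0 rule: finite_induct)
  case empty
  then show ?case by (simp add: exp_sum_def)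
next
  case (insert s S)
  let ?g = "exp_sum (insert s S) (\<lambda>u. b u - b s) c"
  let ?g' = "exp_sum S (\<lambda>u. b u - b s) (\<lambda>u. c u * (b u - b s))"
  have g: "?g t = 0 \<longleftrightarrow> exp_sum (insert s S) b c t = 0" for t
    by (simp add: exp_sum_shift[of "b s", symmetric])
  have g': "(?g has_real_derivative ?g' t) (at t)" for t
    using exp_sum_has_derivative[of "insert s S" "\<lambda>u. b u - b s" c t] insert.hyps
    by (simp add: exp_sum_def)
  show ?case
  proof (cases "\<exists>t. ?g' t \<noteq> 0")
    case True
    then obtain t1 where t1: "?g' t1 \<noteq> 0" by blast
    then have "S \<noteq> {}" by (auto simp: exp_sum_def)
    \<comment> \<open>Makes \<open>Suc (card S - 1)\<close> equal to \<open>card S\<close> in spite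
      of truncated subtraction.\<close>
    then have "card S \<noteq> 0" using insert.hyps by auto
    have "finite {t. ?g t = 0} \<and> card {t. ?g t = 0} \<le> Suc (card S - 1)"
      using insert.IH[OF t1] by (intro card_zeros_le_Suc_card_zeros_deriv[OF g']) auto
    then show ?thesis using \<open>card S \<noteq> 0\<close> insert.hyps by (simp add: g)
  next
    case False
    then have "(?g has_real_derivative 0) (at t)" for t using g' by metis
    then have "?g t = ?g t0" for t by (rule DERIV_isconst_all[rule_format])
    then have "?g t \<noteq> 0" for t using g[of t0] insert.prems by metis
    then show ?thesis by (simp add: g)
  qed
qed

text \<open>Collecting equal exponents lets zeros be counted by distinct exponents. Elements of
  \<open>B\<close> that are not attained get an empty sum, hence coefficient 0.\<close>

lemma exp_sum_group:
  assumes "finite S" "finite B" "b ` S \<subseteq> B"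
  shows "exp_sum S b c = exp_sum B (\<lambda>r. r) (\<lambda>r. \<Sum>s | s \<in> S \<and> b s = r. c s)"
proof
  fix t
  have "exp_sum S b c t = (\<Sum>r\<in>B. \<Sum>s | s \<in> S \<and> b s = r. c s * exp (b s * t))"
    unfolding exp_sum_def by (rule sum.group[OF assms, symmetric])
  also have "\<dots> = exp_sum B (\<lambda>r. r) (\<lambda>r. \<Sum>s | s \<in> S \<and> b s = r. c s) t"
    unfolding exp_sum_def sum_distrib_right by (intro sum.cong) auto
  finally show "exp_sum S b c t = \<dots>" .
qed

text \<open>After the factor \<open>exp (r * t)\<close> is divided out, terms with exponent below
  \<open>r\<close> tend to 0, those above have coefficient 0, and those at \<open>r\<close> leave a
  negative constant.\<close>

lemma exp_sum_dominating_term: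
  assumes "finite S" and top: "\<And>s. s \<in> S \<Longrightarrow> r < b s \<Longrightarrow> c s = 0"
    and neg: "\<And>s. s \<in> S \<Longrightarrow> b s = r \<Longrightarrow> c s < 0" and "s0 \<in> S" "b s0 = r"
  shows "\<forall>\<^sub>F t in at_top. exp_sum S b c t < 0"
proof -
  let ?l = "\<lambda>s. if b s = r then c s else 0"
  have "((\<lambda>t. c s * exp ((b s - r) * t)) \<longlongrightarrow> ?l s) at_top" if "s \<in> S" for s
  proof (cases "b s < r")
    case True
    then have "filterlim (\<lambda>t. (b s - r) * t) at_bot at_top"
      by (intro filterlim_tendsto_neg_mult_at_bot[OF tendsto_const] filterlim_ident) auto
    then have "((\<lambda>t. exp ((b s - r) * t)) \<longlongrightarrow> 0) at_top"
      by (rule filterlim_compose[OF exp_at_bot])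
    then show ?thesis using True tendsto_mult_right_zero by auto
  next
    case False
    then show ?thesis using top[OF that] by (cases "b s = r") auto
  qed
  then have "(exp_sum S (\<lambda>s. b s - r) c \<longlongrightarrow> (\<Sum>s\<in>S. ?l s)) at_top"
    unfolding exp_sum_def by (intro tendsto_sum)
  moreover have "(\<Sum>s\<in>S. - ?l s) > 0"
    by (rule sum_pos2[OF \<open>finite S\<close> \<open>s0 \<in> S\<close>]) (use neg assms(4,5) in \<open>auto intro: less_imp_le\<close>)
  ultimately have "\<forall>\<^sub>F t in at_top. exp_sum S (\<lambda>s. b s - r) c t < 0"
    by (intro order_tendstoD(2)) (auto simp: sum_negf)
  then show ?thesis
    by (auto simp: exp_sum_shift[symmetric] mult_less_0_iff elim!: eventually_mono)
qed

section \<open>Parity of the number of sign changes\<close>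

text \<open>The pattern of \<open>inflection_point\<close> for an arbitrary function, so that a
  second derivative can be replaced by any function of the same sign.\<close>

definition sign_change :: "(real \<Rightarrow> real) \<Rightarrow> real \<Rightarrow> bool" where
  "sign_change f p \<longleftrightarrow>
     ((\<forall>\<^sub>F q in at_left p. f q > 0) \<and> (\<forall>\<^sub>F q in at_right p. f q < 0)) \<or>
     ((\<forall>\<^sub>F q in at_left p. f q < 0) \<and> (\<forall>\<^sub>F q in at_right p. f q > 0))"

lemma sign_change_imp_zero:
  assumes "isCont f p" "sign_change f p"
  shows "f p = 0"
proof -
  have l: "(f \<longlongrightarrow> f p) (at_left p)" and r: "(f \<longlongrightarrow> f p) (at_right p)"
    using assms(1) by (simp_all add: isCont_def filterlim_at_split)
  have pos: "\<forall>\<^sub>F q in F. f q \<ge> 0" if "\<forall>\<^sub>F q in F. f q > 0" for F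
    using that by (rule eventually_mono) simp
  have neg: "\<forall>\<^sub>F q in F. f q \<le> 0" if "\<forall>\<^sub>F q in F. f q < 0" for F
    using that by (rule eventually_mono) simp
  show ?thesis
    using assms(2) unfolding sign_change_def
  proof (elim disjE conjE)
    assume "\<forall>\<^sub>F q in at_left p. f q > 0" "\<forall>\<^sub>F q in at_right p. f q < 0"
    then have "f p \<ge> 0" "f p \<le> 0"
      using tendsto_lowerbound[OF l pos] tendsto_upperbound[OF r neg] by simp_all
    then show ?thesis by simp
  next
    assume "\<forall>\<^sub>F q in at_left p. f q < 0" "\<forall>\<^sub>F q in at_right p. f q > 0"
    then have "f p \<le> 0" "f p \<ge> 0"
      using tendsto_upperbound[OF l neg] tendsto_lowerbound[OF r pos] by simp_all
    then show ?thesis by simp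
  qed
qed

text \<open>Intermediate value theorem. \<open>closed_segment\<close> leaves the order of
  \<open>u\<close> and \<open>v\<close> open; both orders occur below.\<close>

lemma no_zero_imp_same_sign:
  fixes f :: "real \<Rightarrow> real"
  assumes "\<And>t. isCont f t" "\<And>t. t \<in> closed_segment u v \<Longrightarrow> f t \<noteq> 0"
  shows "f u > 0 \<longleftrightarrow> f v > 0"
proof (rule ccontr)
  assume ne: "\<not> ?thesis"
  have "connected (f ` closed_segment u v)"
    by (intro connected_continuous_image continuous_at_imp_continuous_on) (auto simp: assms)
  moreover have "f u \<in> f ` closed_segment u v" "f v \<in> f ` closed_segment u v" by auto
  moreover have "f u \<le> 0 \<and> 0 \<le> f v \<or> f v \<le> 0 \<and> 0 \<le> f u" using ne by auto
  ultimately have "0 \<in> f ` closed_segment u v"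
    by (meson connectedD_interval)
  with assms show False by auto
qed

text \<open>Reduces a one-sided sign condition to the truth value \<open>P\<close>, so that
  \<open>sign_change\<close> becomes a propositional statement.\<close>

lemma eventually_sign_iff:
  fixes f :: "real \<Rightarrow> real"
  assumes "F \<noteq> bot" and ev: "\<forall>\<^sub>F t in F. f t \<noteq> 0 \<and> (f t > 0 \<longleftrightarrow> P)"
  shows "(\<forall>\<^sub>F t in F. f t > 0) \<longleftrightarrow> P" "(\<forall>\<^sub>F t in F. f t < 0) \<longleftrightarrow> \<not> P"
proof -
  have "(\<forall>\<^sub>F t in F. f t > 0) \<longleftrightarrow> (\<forall>\<^sub>F t in F. P)"
    using ev by (intro eventually_subst) (auto elim: eventually_mono)
  then show "(\<forall>\<^sub>F t in F. f t > 0) \<longleftrightarrow> P"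
    using assms(1) by (simp add: eventually_const)
  have "(\<forall>\<^sub>F t in F. f t < 0) \<longleftrightarrow> (\<forall>\<^sub>F t in F. \<not> P)"
    using ev by (intro eventually_subst) (auto elim!: eventually_mono)
  then show "(\<forall>\<^sub>F t in F. f t < 0) \<longleftrightarrow> \<not> P"
    using assms(1) by (simp add: eventually_const)
qed

text \<open>Induction on the number of zeros between \<open>u\<close> and \<open>v\<close>: the last
  zero \<open>z\<close> is cut off by moving \<open>v\<close> to a point \<open>w\<close> just left
  of \<open>z\<close>. There is a sign change at \<open>z\<close> exactly if the signs at
  \<open>w\<close> and \<open>v\<close> differ, so both sides of the equivalence flip
  together.\<close>

lemma even_card_sign_changes_iff:
  fixes f :: "real \<Rightarrow> real"
  assumes cont: "\<And>t. isCont f t" and "finite {t. f t = 0}"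
    and "u < v" "f u \<noteq> 0" "f v \<noteq> 0"
  shows "even (card {p. sign_change f p \<and> u < p \<and> p < v}) \<longleftrightarrow> (f u > 0 \<longleftrightarrow> f v > 0)"
  using assms(3-)
proof (induction "card {t. f t = 0 \<and> u < t \<and> t < v}" arbitrary: v rule: less_induct)
  case less
  let ?Z = "{t. f t = 0 \<and> u < t \<and> t < v}"
  let ?S = "\<lambda>v. {p. sign_change f p \<and> u < p \<and> p < v}"
  have fin: "finite {t. f t = 0 \<and> P t}" for P
    using assms(2) by (rule rev_finite_subset) auto
  have S_zero: "f p = 0" if "sign_change f p" for p
    using sign_change_imp_zero[OF cont that] .
  show ?case
  proof (cases "?Z = {}")
    case True
    have "f u > 0 \<longleftrightarrow> f v > 0"
    proof (intro no_zero_imp_same_sign[OF cont])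
      fix t assume "t \<in> closed_segment u v"
      then have "t = u \<or> t = v \<or> u < t \<and> t < v"
        using \<open>u < v\<close> by (auto simp: closed_segment_eq_real_ivl)
      then show "f t \<noteq> 0" using less.prems True by blast
    qed
    moreover have "?S v = {}" using True S_zero by auto
    then have "card (?S v) = 0" by (simp only: card.empty)
    ultimately show ?thesis by simp
  next
    case False
    define z where "z = Max ?Z"
    have "z \<in> ?Z" unfolding z_def by (rule Max_in[OF fin False])
    then have z: "f z = 0" "u < z" "z < v" by blast+
    have z_max: "t \<le> z" if "f t = 0" "u < t" "t < v" for t
      unfolding z_def using that fin by (intro Max_ge) auto
    \<comment> \<open>Inserting \<open>u\<close> covers the case of no zero before \<open>z\<close>;
      the midpoint \<open>w\<close> of \<open>y\<close> and \<open>z\<close> then has no zero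
      between itself and \<open>z\<close>.\<close>
    let ?Y = "insert u {t. f t = 0 \<and> u < t \<and> t < z}"
    define y where "y = Max ?Y"
    have "y \<in> ?Y" unfolding y_def by (rule Max_in) (simp_all add: fin)
    moreover have "t \<le> y" if "t \<in> ?Y" for t
      unfolding y_def using that by (intro Max_ge) (simp_all add: fin)
    ultimately have y: "u \<le> y" "y < z" "\<And>t. f t = 0 \<Longrightarrow> u < t \<Longrightarrow> t < z \<Longrightarrow> t \<le> y"
      using z by auto
    define w where "w = (y + z) / 2"
    have w: "u < w" "w < z" "y < w" using y by (auto simp: w_def)
    have w0: "f t \<noteq> 0" if "w \<le> t" "t < z" for t
      using y(3)[of t] that w by force
    have v0: "f t \<noteq> 0" if "z < t" "t \<le> v" for t
    proof (cases "t = v")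
      case False
      with that z have "u < t" "t < v" by auto
      with z_max[of t] that show ?thesis by linarith
    qed (use less.prems in simp)
    have left: "f t > 0 \<longleftrightarrow> f w > 0" if "w \<le> t" "t < z" for t
      using that w0
      by (intro no_zero_imp_same_sign[OF cont]) (auto simp: closed_segment_eq_real_ivl split: if_splits)
    have right: "f t > 0 \<longleftrightarrow> f v > 0" if "z < t" "t \<le> v" for t
      using that v0
      by (intro no_zero_imp_same_sign[OF cont]) (auto simp: closed_segment_eq_real_ivl split: if_splits)
    have ev_left: "\<forall>\<^sub>F t in at_left z. f t \<noteq> 0 \<and> (f t > 0 \<longleftrightarrow> f w > 0)"
      using eventually_at_left_real[OF w(2)]
      by (rule eventually_mono) (meson left w0 greaterThanLessThan_iff less_imp_le)
    have ev_right: "\<forall>\<^sub>F t in at_right z. f t \<noteq> 0 \<and> (f t > 0 \<longleftrightarrow> f v > 0)"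
      using eventually_at_right_real[OF z(3)]
      by (rule eventually_mono) (meson right v0 greaterThanLessThan_iff less_imp_le)
    note l = eventually_sign_iff[OF trivial_limit_at_left_real ev_left]
    note r = eventually_sign_iff[OF trivial_limit_at_right_real ev_right]
    have "f w \<noteq> 0" using w0[of w] w by auto
    have sc: "sign_change f z \<longleftrightarrow> (f w > 0) \<noteq> (f v > 0)"
      unfolding sign_change_def l r by blast
    have IH: "even (card (?S w)) \<longleftrightarrow> (f u > 0 \<longleftrightarrow> f w > 0)"
    proof (rule less.hyps)
      have "{t. f t = 0 \<and> u < t \<and> t < w} \<subseteq> ?Z - {z}"
        using z w by auto
      then have "card {t. f t = 0 \<and> u < t \<and> t < w} \<le> card (?Z - {z})"
        by (intro card_mono finite_Diff fin)
      also have "\<dots> < card ?Z"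
        by (rule card_Diff1_less[OF fin \<open>z \<in> ?Z\<close>])
      finally show "card {t. f t = 0 \<and> u < t \<and> t < w} < card ?Z" .
    qed (use w \<open>f w \<noteq> 0\<close> less.prems in auto)
    have S: "?S v = ?S w \<union> (if sign_change f z then {z} else {})"
    proof -
      have "p < w \<or> p = z" if "sign_change f p" "u < p" "p < v" for p
        using S_zero[OF that(1)] w0[of p] z_max[OF _ that(2,3)] by linarith
      moreover have "p < v" if "p < w" for p
        using that w z by linarith
      ultimately show ?thesis using z by (auto split: if_splits)
    qed
    have "finite (?S w)" by (rule finite_subset[OF _ assms(2)]) (auto simp: S_zero)
    then have "card (?S v) = card (?S w) + (if sign_change f z then 1 else 0)"
      unfolding S using w by (auto simp: card_insert_if)
    then show ?thesis using IH sc by auto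
  qed
qed

section \<open>The second derivative of the Lehmer mean\<close>

lemma triple_sum_product:
  fixes f g h :: "'a \<Rightarrow> real"
  shows "(\<Sum>(i, j, k)\<in>I \<times> I \<times> I. f i * g j * h k) = sum f I * sum g I * sum h I"
  by (simp add: sum.cartesian_product[symmetric] sum_distrib_left[symmetric] sum_distrib_right[symmetric])

text \<open>Symmetrized over the three indices, so that the coefficients of the dominating exponents
  need no grouping of terms to determine their sign.\<close>

definition lehmer_coeff :: "('a \<Rightarrow> real) \<Rightarrow> ('a \<Rightarrow> real) \<Rightarrow> 'a \<times> 'a \<times> 'a \<Rightarrow> real" where
  "lehmer_coeff x a = (\<lambda>(i, j, k).
     x i * (2 * a i * a i - a j * a j - a k * a k - 2 * a i * a j - 2 * a i * a k + 4 * a j * a k) +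
     x j * (2 * a j * a j - a k * a k - a i * a i - 2 * a j * a k - 2 * a j * a i + 4 * a k * a i) +
     x k * (2 * a k * a k - a i * a i - a j * a j - 2 * a k * a i - 2 * a k * a j + 4 * a i * a j))"

text \<open>Moves any repeated pair of a triple into the first two places.\<close>

lemma lehmer_coeff_rotate: "lehmer_coeff x a (i, j, k) = lehmer_coeff x a (j, k, i)"
  unfolding lehmer_coeff_def by (simp add: algebra_simps)

text \<open>Yields both the vanishing on the diagonal (\<open>a k = a i\<close>) and the sign of the
  extreme coefficients. Only values are compared, so distinct indices with equal \<open>x\<close>
  are covered.\<close>

lemma lehmer_coeff_repeated:
  assumes "x i = x j" "a i = a j"
  shows "lehmer_coeff x a (i, j, k) = 2 * (x k - x i) * (a i - a k)\<^sup>2"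
  unfolding lehmer_coeff_def using assms by (simp add: algebra_simps power2_eq_square)

text \<open>The right side is a multiple of the numerator of the second derivative of
  \<open>N / D\<close>. Each of the three rotated lines of \<open>lehmer_coeff\<close> contributes
  it twice, whence the factor 6.\<close>

lemma sum_lehmer_coeff:
  fixes x a w :: "'a \<Rightarrow> real" and I :: "'a set"
  defines "D \<equiv> \<Sum>i\<in>I. w i" and "D1 \<equiv> \<Sum>i\<in>I. w i * a i" and "D2 \<equiv> \<Sum>i\<in>I. w i * a i * a i"
    and "N \<equiv> \<Sum>i\<in>I. x i * w i" and "N1 \<equiv> \<Sum>i\<in>I. x i * w i * a i"
    and "N2 \<equiv> \<Sum>i\<in>I. x i * w i * a i * a i"
  shows "(\<Sum>(i, j, k)\<in>I \<times> I \<times> I. lehmer_coeff x a (i, j, k) * (w i * w j * w k)) =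
    6 * ((N2 * D - N * D2) * D - 2 * D1 * (N1 * D - N * D1))"
proof -
  define W1 W2 X X1 X2 where W: "W1 = (\<lambda>i. w i * a i)" "W2 = (\<lambda>i. w i * a i * a i)"
    "X = (\<lambda>i. x i * w i)" "X1 = (\<lambda>i. x i * w i * a i)" "X2 = (\<lambda>i. x i * w i * a i * a i)"
  \<comment> \<open>Every monomial splits into one factor per index, so
    \<open>triple_sum_product\<close> applies to each.\<close>
  define P where "P f g h = (\<lambda>(i, j, k). f i * g j * h k :: real)" for f g h :: "'a \<Rightarrow> real"
  have P: "sum (P f g h) (I \<times> I \<times> I) = sum f I * sum g I * sum h I" for f g h
    unfolding P_def by (rule triple_sum_product)
  have "(\<Sum>(i, j, k)\<in>I \<times> I \<times> I. lehmer_coeff x a (i, j, k) * (w i * w j * w k)) =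
    (\<Sum>t\<in>I \<times> I \<times> I.
      2 * P X2 w w t - P X W2 w t - P X w W2 t - 2 * P X1 W1 w t - 2 * P X1 w W1 t + 4 * P X W1 W1 t +
      (2 * P w X2 w t - P w X W2 t - P W2 X w t - 2 * P w X1 W1 t - 2 * P W1 X1 w t + 4 * P W1 X W1 t) +
      (2 * P w w X2 t - P W2 w X t - P w W2 X t - 2 * P W1 w X1 t - 2 * P w W1 X1 t + 4 * P W1 W1 X t))"
    by (rule sum.cong) (auto simp: P_def W lehmer_coeff_def algebra_simps)
  also have "\<dots> = 6 * ((N2 * D - N * D2) * D - 2 * D1 * (N1 * D - N * D1))"
    unfolding D_def D1_def D2_def N_def N1_def N2_def
    by (simp only: sum.distrib sum_subtractf sum_distrib_left[symmetric] P W) (simp add: algebra_simps)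
  finally show ?thesis .
qed

text \<open>One factor \<open>D\<close> cancels, which leaves a cubic numerator; this is why triples
  of indices occur.\<close>

lemma deriv_deriv_quotient:
  fixes N D :: "real \<Rightarrow> real"
  assumes N: "\<And>t. (N has_real_derivative N1 t) (at t)" "\<And>t. (N1 has_real_derivative N2 t) (at t)"
    and D: "\<And>t. (D has_real_derivative D1 t) (at t)" "\<And>t. (D1 has_real_derivative D2 t) (at t)"
    and D0: "\<And>t. D t \<noteq> 0"
  shows "deriv (deriv (\<lambda>t. N t / D t)) t =
    ((N2 t * D t - N t * D2 t) * D t - 2 * D1 t * (N1 t * D t - N t * D1 t)) / D t ^ 3"
proof -
  have "deriv (\<lambda>t. N t / D t) = (\<lambda>t. (N1 t * D t - N t * D1 t) / (D t * D t))"
    by (intro ext DERIV_imp_deriv) (rule DERIV_divide[OF N(1) D(1) D0])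
  moreover have "((\<lambda>t. (N1 t * D t - N t * D1 t) / (D t * D t)) has_real_derivative
    ((N2 t * D t - N t * D2 t) * D t - 2 * D1 t * (N1 t * D t - N t * D1 t)) / D t ^ 3) (at t)"
    using D0[of t]
    by (auto intro!: derivative_eq_intros N D simp: divide_simps) (simp add: algebra_simps power3_eq_cube)
  ultimately show ?thesis by (simp add: DERIV_imp_deriv)
qed

lemma deriv_deriv_exp_sum_quotient:
  fixes x y a :: "'a \<Rightarrow> real"
  assumes "finite I" "I \<noteq> {}" and y: "\<And>i. i \<in> I \<Longrightarrow> y i > 0"
  shows "deriv (deriv (\<lambda>t. exp_sum I a (\<lambda>i. x i * y i) t / exp_sum I a y t)) t =
    exp_sum (I \<times> I \<times> I) (\<lambda>(i, j, k). a i + a j + a k)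
      (\<lambda>(i, j, k). lehmer_coeff x a (i, j, k) * (y i * y j * y k)) t / (6 * exp_sum I a y t ^ 3)"
proof -
  have D0: "exp_sum I a y t \<noteq> 0" for t
    unfolding exp_sum_def using assms by (intro less_imp_neq[symmetric] sum_pos) auto
  let ?w = "\<lambda>i. y i * exp (a i * t)"
  have "exp_sum (I \<times> I \<times> I) (\<lambda>(i, j, k). a i + a j + a k)
      (\<lambda>(i, j, k). lehmer_coeff x a (i, j, k) * (y i * y j * y k)) t =
    (\<Sum>(i, j, k)\<in>I \<times> I \<times> I. lehmer_coeff x a (i, j, k) * (?w i * ?w j * ?w k))"
    unfolding exp_sum_def by (rule sum.cong) (auto simp: distrib_right exp_add)
  also have "\<dots> = 6 *
    ((exp_sum I a (\<lambda>i. x i * y i * a i * a i) t * exp_sum I a y t -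
      exp_sum I a (\<lambda>i. x i * y i) t * exp_sum I a (\<lambda>i. y i * a i * a i) t) * exp_sum I a y t -
     2 * exp_sum I a (\<lambda>i. y i * a i) t * (exp_sum I a (\<lambda>i. x i * y i * a i) t * exp_sum I a y t -
      exp_sum I a (\<lambda>i. x i * y i) t * exp_sum I a (\<lambda>i. y i * a i) t))"
    unfolding sum_lehmer_coeff by (simp add: exp_sum_def mult_ac)
  finally have eq: "exp_sum (I \<times> I \<times> I) (\<lambda>(i, j, k). a i + a j + a k)
      (\<lambda>(i, j, k). lehmer_coeff x a (i, j, k) * (y i * y j * y k)) t = \<dots>" .
  show ?thesis
    unfolding deriv_deriv_quotient[OF exp_sum_has_derivative exp_sum_has_derivative
        exp_sum_has_derivative exp_sum_has_derivative D0] eq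
    by (rule mult_divide_mult_cancel_left[symmetric]) simp
qed

text \<open>Let \<open>A > B\<close> be the two largest values of \<open>a\<close>. Only the
  exponent \<open>3 * A\<close> exceeds \<open>2 * A + B\<close>, and its coefficients vanish;
  \<open>2 * A + B\<close> itself arises only from two values \<open>A\<close> and one
  \<open>B\<close>, with negative coefficients.\<close>

lemma triple_exp_sum_eventually_neg:
  fixes a :: "'a \<Rightarrow> real"
  assumes "finite I" "u \<in> I" "v \<in> I" "a u \<noteq> a v"
    and zero: "\<And>i j k. i \<in> I \<Longrightarrow> j \<in> I \<Longrightarrow> k \<in> I \<Longrightarrow> a i = a j \<Longrightarrow> a j = a k \<Longrightarrow> c (i, j, k) = 0"
    and neg: "\<And>i j k. i \<in> I \<Longrightarrow> j \<in> I \<Longrightarrow> k \<in> I \<Longrightarrow>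
      a i = a j \<and> a k < a i \<or> a j = a k \<and> a i < a j \<or> a k = a i \<and> a j < a k \<Longrightarrow> c (i, j, k) < 0"
  shows "\<forall>\<^sub>F t in at_top. exp_sum (I \<times> I \<times> I) (\<lambda>(i, j, k). a i + a j + a k) c t < 0"
proof -
  define A where "A = Max (a ` I)"
  define B where "B = Max (a ` I - {A})"
  have "A \<in> a ` I" unfolding A_def using assms by (intro Max_in) auto
  then obtain p where p: "p \<in> I" "a p = A" by auto
  have "a ` I - {A} \<noteq> {}" using assms by (metis Diff_eq_empty_iff image_subset_iff singletonD)
  then have "B \<in> a ` I - {A}" unfolding B_def using assms by (intro Max_in) auto
  then obtain q where q: "q \<in> I" "a q = B" "B \<noteq> A" by auto
  have le: "a i \<le> A" if "i \<in> I" for i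
    unfolding A_def using that assms by (intro Max_ge) auto
  have AB: "a i = A \<or> a i \<le> B" if "i \<in> I" for i
    unfolding B_def using that assms by (cases "a i = A") (auto intro!: Max_ge)
  have "B < A" using le[OF q(1)] q by auto
  show ?thesis
  proof (rule exp_sum_dominating_term[where r = "2 * A + B" and ?s0.0 = "(p, p, q)"])
    fix s assume s: "s \<in> I \<times> I \<times> I"
    obtain i j k where ijk: "s = (i, j, k)" by (cases s)
    note * = s[unfolded ijk] le[of i] le[of j] le[of k] AB[of i] AB[of j] AB[of k]
    show "c s = 0" if "2 * A + B < (case s of (i, j, k) \<Rightarrow> a i + a j + a k)"
    proof -
      have "a i = A" "a j = A" "a k = A" using * that ijk by auto
      then show ?thesis unfolding ijk using s ijk by (intro zero) auto
    qed
    show "c s < 0" if "(case s of (i, j, k) \<Rightarrow> a i + a j + a k) = 2 * A + B"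
    proof -
      have "a i = A \<and> a j = A \<and> a k = B \<or> a j = A \<and> a k = A \<and> a i = B \<or> a k = A \<and> a i = A \<and> a j = B"
        using * that ijk \<open>B < A\<close> by auto
      then show ?thesis unfolding ijk using s ijk \<open>B < A\<close> by (intro neg) auto
    qed
  qed (use assms p q in auto)
qed

lemma lehmer_exp_sum_eventually:
  fixes x y a :: "'a \<Rightarrow> real" and I :: "'a set"
  assumes "finite I" "u \<in> I" "v \<in> I" "a u \<noteq> a v"
    and y: "\<And>i. i \<in> I \<Longrightarrow> y i > 0"
    and mono: "\<And>i j. i \<in> I \<Longrightarrow> j \<in> I \<Longrightarrow> x i < x j \<longleftrightarrow> a i < a j"
  defines "G \<equiv> exp_sum (I \<times> I \<times> I) (\<lambda>(i, j, k). a i + a j + a k)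
      (\<lambda>(i, j, k). lehmer_coeff x a (i, j, k) * (y i * y j * y k))"
  shows "\<forall>\<^sub>F t in at_top. G t < 0" "\<forall>\<^sub>F t in at_top. G (- t) > 0"
proof -
  have eq: "x i = x j" if "a i = a j" "i \<in> I" "j \<in> I" for i j
    using mono[of i j] mono[of j i] that by auto
  have zero: "lehmer_coeff x a (i, j, k) = 0" if "i \<in> I" "j \<in> I" "k \<in> I" "a i = a j" "a j = a k" for i j k
    using lehmer_coeff_repeated[of x i j a k] eq[of i j] that by simp
  have neg: "lehmer_coeff x a (i, j, k) < 0" if "i \<in> I" "j \<in> I" "k \<in> I" "a i = a j" "a k < a i" for i j k
    using lehmer_coeff_repeated[of x i j a k] eq[of i j] mono[of k i] that
    by (simp add: mult_neg_pos)
  have pos: "lehmer_coeff x a (i, j, k) > 0" if "i \<in> I" "j \<in> I" "k \<in> I" "a i = a j" "a i < a k" for i j k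
    using lehmer_coeff_repeated[of x i j a k] eq[of i j] mono[of i k] that by simp
  have "lehmer_coeff x a (i, j, k) < 0"
    if "i \<in> I" "j \<in> I" "k \<in> I"
      "a i = a j \<and> a k < a i \<or> a j = a k \<and> a i < a j \<or> a k = a i \<and> a j < a k" for i j k
    using that neg[of i j k] neg[of j k i] neg[of k i j]
      lehmer_coeff_rotate[of x a i j k] lehmer_coeff_rotate[of x a j k i] by metis
  then show "\<forall>\<^sub>F t in at_top. G t < 0"
    unfolding G_def using assms(1-4) zero y
    by (intro triple_exp_sum_eventually_neg[of I u v]) (auto simp: mult_neg_pos)
  have "lehmer_coeff x a (i, j, k) > 0"
    if "i \<in> I" "j \<in> I" "k \<in> I"
      "a i = a j \<and> a k > a i \<or> a j = a k \<and> a i > a j \<or> a k = a i \<and> a j > a k" for i j k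
    using that pos[of i j k] pos[of j k i] pos[of k i j]
      lehmer_coeff_rotate[of x a i j k] lehmer_coeff_rotate[of x a j k i] by metis
  \<comment> \<open>Reflecting \<open>t\<close> negates the exponents, so the smallest become
    dominant; negating the coefficients as well restores the sign needed for
    \<open>triple_exp_sum_eventually_neg\<close>.\<close>
  then have "\<forall>\<^sub>F t in at_top. exp_sum (I \<times> I \<times> I) (\<lambda>(i, j, k). (- a i) + (- a j) + (- a k))
      (\<lambda>(i, j, k). - (lehmer_coeff x a (i, j, k) * (y i * y j * y k))) t < 0"
    using assms(1-4) zero y
    by (intro triple_exp_sum_eventually_neg[of I u v]) auto
  moreover have "exp_sum (I \<times> I \<times> I) (\<lambda>(i, j, k). (- a i) + (- a j) + (- a k))
      (\<lambda>(i, j, k). - (lehmer_coeff x a (i, j, k) * (y i * y j * y k))) t = - G (- t)" for t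
    unfolding G_def exp_sum_def sum_negf[symmetric] by (rule sum.cong) (auto simp: algebra_simps)
  ultimately show "\<forall>\<^sub>F t in at_top. G (- t) > 0" by simp
qed

section \<open>Counting the exponents\<close>

lemma choose_3: "6 * (n choose 3) = n * (n - 1) * (n - 2)"
proof -
  consider "n < 2" | m where "n = Suc (Suc m)"
    by (metis not_less_eq_eq numeral_2_eq_2 less_2_cases_iff not0_implies_Suc not_less_eq)
  then show ?thesis
  proof cases
    case 2
    have "3 * (n choose 3) = n * (Suc m choose 2)"
      using Suc_times_binomial[of 2 "Suc m"] 2 by (simp add: numeral_eq_Suc)
    moreover have "2 * (Suc m choose 2) = Suc m * m"
      using Suc_times_binomial[of 1 m] by (simp add: numeral_eq_Suc)
    ultimately have "6 * (n choose 3) = n * (Suc m * m)"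
      by (metis (no_types, lifting) mult.assoc mult.left_commute mult_2 numeral_Bit0 distrib_right)
    then show ?thesis using 2 by (simp del: mult_Suc mult_Suc_right)
  qed (auto simp: binomial_eq_0 less_2_cases_iff)
qed

text \<open>A triple off the diagonal either repeats one index, and is given by an ordered pair of
  distinct indices, or has three distinct indices, and then its sum depends only on their
  set.\<close>

lemma triple_exponents_bound:
  fixes a :: "'a \<Rightarrow> real"
  assumes "finite I"
  obtains B where "finite B" "card B \<le> card I * (card I - 1) + (card I choose 3)"
    "\<And>i j k. i \<in> I \<Longrightarrow> j \<in> I \<Longrightarrow> k \<in> I \<Longrightarrow> \<not> (i = j \<and> j = k) \<Longrightarrow> a i + a j + a k \<in> B"
proof -
  let ?P = "I \<times> I - (\<lambda>i. (i, i)) ` I" and ?Q = "{A. A \<subseteq> I \<and> card A = 3}"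
  let ?f = "\<lambda>(i, j). a i + a i + a j"
  have fin: "finite ?P" "finite ?Q" using assms by auto
  have "card ?P = card I * (card I - 1)"
    using assms by (subst card_Diff_subset)
      (auto simp: card_cartesian_product card_image inj_on_def diff_mult_distrib2)
  moreover have "card ?Q = card I choose 3" using n_subsets[OF assms] .
  ultimately have "card (?f ` ?P \<union> sum a ` ?Q) \<le> card I * (card I - 1) + (card I choose 3)"
    using card_Un_le[of "?f ` ?P" "sum a ` ?Q"] card_image_le[OF fin(1), of ?f]
      card_image_le[OF fin(2), of "sum a"] by linarith
  moreover have "a i + a j + a k \<in> ?f ` ?P \<union> sum a ` ?Q"
    if I: "i \<in> I" "j \<in> I" "k \<in> I" "\<not> (i = j \<and> j = k)" for i j k
  proof -
    have f: "a p + a p + a q \<in> ?f ` ?P" if "p \<in> I" "q \<in> I" "p \<noteq> q" for p q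
      using that by (intro image_eqI[of _ _ "(p, q)"]) auto
    consider "i = j" "i \<noteq> k" | "i = k" "i \<noteq> j" | "j = k" "j \<noteq> i" | "i \<noteq> j" "j \<noteq> k" "i \<noteq> k"
      using I by blast
    then show ?thesis
    proof cases
      case 1 then show ?thesis using f[of i k] I by simp
    next
      case 2 then show ?thesis using f[of i j] I by (simp add: add_ac)
    next
      case 3 then show ?thesis using f[of j i] I by (simp add: add_ac)
    next
      case 4
      then have "a i + a j + a k = sum a {i, j, k}" "{i, j, k} \<in> ?Q" using I by auto
      then show ?thesis by blast
    qed
  qed
  ultimately show ?thesis using that[of "?f ` ?P \<union> sum a ` ?Q"] fin by blast
qed

text \<open>The number of available exponents is one more than the bound;
  \<open>exp_sum_zeros\<close> takes off that one.\<close>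

lemma Suc_inflection_bound:
  assumes "n \<ge> 2"
  shows "n * (n - 1) + (n choose 3) = Suc (inflection_bound n)"
proof -
  have "6 * (n * (n - 1) + (n choose 3)) = n * (n + 4) * (n - 1)"
    using choose_3[of n] assms by (cases n; cases "n - 1") (auto simp: algebra_simps)
  then have "inflection_bound n = n * (n - 1) + (n choose 3) - 1"
    unfolding inflection_bound_def by simp
  moreover have "n * (n - 1) > 0" using assms by simp
  ultimately show ?thesis by linarith
qed

section \<open>Inflection points of the Lehmer mean\<close>

theorem theorem2:
  fixes n :: nat and x :: "nat \<Rightarrow> real"
  assumes "n \<ge> 2"
    and "\<And>i. i \<in> {1..n} \<Longrightarrow> x i > 0"
  shows "finite {p. inflection_point (lehmer_mean n x) p} \<and>
         card {p. inflection_point (lehmer_mean n x) p} \<le> inflection_bound n \<and>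
         (even (inflection_bound n) \<longrightarrow>
            card {p. inflection_point (lehmer_mean n x) p} \<le> inflection_bound n - 1)"
proof -
  let ?I = "{1..n}"
  let ?T = "?I \<times> ?I \<times> ?I"
  \<comment> \<open>With these, \<open>x i powr (p - 1)\<close> is
    \<open>y i * exp (a i * p)\<close>, and the numerator has coefficients \<open>x i * y i\<close>,
    the form needed for \<open>deriv_deriv_exp_sum_quotient\<close>.\<close>
  define a y where "a = (\<lambda>i. ln (x i))" and "y = (\<lambda>i. 1 / x i)"
  let ?b = "\<lambda>(i, j, k). a i + a j + a k"
  let ?c = "\<lambda>(i, j, k). lehmer_coeff x a (i, j, k) * (y i * y j * y k)"
  define G where "G = exp_sum ?T ?b ?c"
  note x = assms(2)
  have y: "y i > 0" if "i \<in> ?I" for i using x[OF that] by (simp add: y_def)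
  have D: "exp_sum ?I a y p > 0" for p
    unfolding exp_sum_def using assms(1) y by (intro sum_pos) auto
  have "lehmer_mean n x = (\<lambda>p. exp_sum ?I a (\<lambda>i. x i * y i) p / exp_sum ?I a y p)"
  proof
    fix p
    have "(\<Sum>i=1..n. x i powr p) = exp_sum ?I a (\<lambda>i. x i * y i) p"
      unfolding exp_sum_def
    proof (rule sum.cong[OF refl])
      fix i assume "i \<in> ?I"
      from x[OF this] show "x i powr p = x i * y i * exp (a i * p)"
        by (simp add: a_def y_def powr_def mult.commute)
    qed
    moreover have "(\<Sum>i=1..n. x i powr (p - 1)) = exp_sum ?I a y p"
      unfolding exp_sum_def
    proof (rule sum.cong[OF refl])
      fix i assume "i \<in> ?I"
      from x[OF this] show "x i powr (p - 1) = y i * exp (a i * p)"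
        by (simp add: a_def y_def powr_def left_diff_distrib exp_diff mult.commute)
    qed
    ultimately show "lehmer_mean n x p = exp_sum ?I a (\<lambda>i. x i * y i) p / exp_sum ?I a y p"
      by (simp add: lehmer_mean_def)
  qed
  then have L: "deriv (deriv (lehmer_mean n x)) p = G p / (6 * exp_sum ?I a y p ^ 3)" for p
    using deriv_deriv_exp_sum_quotient[of ?I y a x p] y assms(1) by (simp add: G_def)
  have D3: "6 * exp_sum ?I a y p ^ 3 > 0" for p using D by simp
  have infl: "inflection_point (lehmer_mean n x) = sign_change G"
    unfolding inflection_point_def sign_change_def fun_eq_iff L
      zero_less_divide_iff divide_less_0_iff using D3 by (simp only: less_not_sym simp_thms)
  show ?thesis
  proof (cases "\<exists>t. G t \<noteq> 0")
    case False
    then have "{p. inflection_point (lehmer_mean n x) p} = {}"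
      by (simp add: infl sign_change_def)
    then show ?thesis by simp
  next
    case True
    then obtain t0 where t0: "G t0 \<noteq> 0" by blast
    have diag: "?c (i, j, k) = 0" if "i \<in> ?I" "j \<in> ?I" "k \<in> ?I" "a i = a j" "a j = a k" for i j k
    proof -
      have "x i = x j" using that x by (simp add: a_def)
      then show ?thesis using lehmer_coeff_repeated[of x i j a k] that by simp
    qed
    \<comment> \<open>Dropping the diagonal, where the coefficients vanish, keeps the exponents
      \<open>3 * a i\<close> out of the count.\<close>
    define T where "T = {(i, j, k). i \<in> ?I \<and> j \<in> ?I \<and> k \<in> ?I \<and> \<not> (i = j \<and> j = k)}"
    have "T \<subseteq> ?T" by (auto simp: T_def)
    then have "finite T" by (rule finite_subset) auto
    have GT: "G = exp_sum T ?b ?c"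
      unfolding G_def exp_sum_def fun_eq_iff
    proof (intro allI sum.mono_neutral_right ballI \<open>T \<subseteq> ?T\<close>)
      fix t s assume "s \<in> ?T - T"
      then show "?c s * exp (?b s * t) = 0" using diag by (cases s) (auto simp: T_def)
    qed auto
    obtain B where B: "finite B" "card B \<le> Suc (inflection_bound n)"
      "\<And>i j k. i \<in> ?I \<Longrightarrow> j \<in> ?I \<Longrightarrow> k \<in> ?I \<Longrightarrow> \<not> (i = j \<and> j = k) \<Longrightarrow> a i + a j + a k \<in> B"
      using triple_exponents_bound[of ?I a] Suc_inflection_bound[OF assms(1)] by auto
    have "?b ` T \<subseteq> B" using B(3) by (auto simp: T_def)
    note GB = exp_sum_group[OF \<open>finite T\<close> B(1) this, of ?c, folded GT]
    have zeros: "finite {t. G t = 0} \<and> card {t. G t = 0} \<le> card B - 1"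
      using exp_sum_zeros[OF B(1)] t0 unfolding GB by blast
    have cont: "isCont G t" for t unfolding G_def by (rule isCont_exp_sum)
    let ?S = "{p. sign_change G p}"
    have S_zero: "G p = 0" if "sign_change G p" for p
      using sign_change_imp_zero[OF cont that] .
    have "card ?S \<le> card {t. G t = 0}" "finite ?S"
      using zeros S_zero by (auto intro!: card_mono intro: rev_finite_subset)
    then have card: "card ?S \<le> inflection_bound n" using zeros B(2) by linarith
    \<comment> \<open>If \<open>a\<close> were constant, every coefficient would vanish by
      \<open>diag\<close>, contrary to \<open>t0\<close>.\<close>
    have "\<exists>u\<in>?I. \<exists>v\<in>?I. a u \<noteq> a v"
    proof (rule ccontr)
      assume const: "\<not> ?thesis"
      have "?c s = 0" if sT: "s \<in> ?T" for s
      proof -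
        obtain i j k where s: "s = (i, j, k)" "i \<in> ?I" "j \<in> ?I" "k \<in> ?I"
          using sT by (cases s) auto
        then have "a i = a j" "a j = a k" using const by blast+
        then show ?thesis unfolding s(1) by (rule diag[OF s(2-4)])
      qed
      then have "G t0 = 0" unfolding G_def exp_sum_def by (intro sum.neutral) auto
      with t0 show False by simp
    qed
    then obtain u v where uv: "u \<in> ?I" "v \<in> ?I" "a u \<noteq> a v" by blast
    have mono: "x i < x j \<longleftrightarrow> a i < a j" if "i \<in> ?I" "j \<in> ?I" for i j
      using that x by (simp add: a_def)
    note ends = lehmer_exp_sum_eventually[of ?I u v a y x, OF _ uv y mono, folded G_def]
    obtain K1 K2 where K1: "\<And>t. t \<ge> K1 \<Longrightarrow> G t < 0" and K2: "\<And>t. t \<ge> K2 \<Longrightarrow> G (- t) > 0"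
      using ends unfolding eventually_at_top_linorder by auto
    \<comment> \<open>The 1 ensures \<open>- K < K\<close>; all zeros of \<open>G\<close> lie
      strictly between these ends, where \<open>G\<close> has opposite signs.\<close>
    define K where "K = max 1 (max K1 K2)"
    have K: "K > 0" "K1 \<le> K" "K2 \<le> K" by (auto simp: K_def)
    have "p < K" "- K < p" if "sign_change G p" for p
      using S_zero[OF that] K1[of p] K2[of "- p"] K by force+
    then have "?S = {p. sign_change G p \<and> - K < p \<and> p < K}" by auto
    moreover have "G (- K) > 0" "G K < 0" using K K1 K2 by auto
    ultimately have "odd (card ?S)"
      using even_card_sign_changes_iff[OF cont, of "- K" K] zeros K(1) by auto
    \<comment> \<open>An odd number not exceeding an even bound is strictly smaller.\<close>
    then show ?thesis
      using card \<open>finite ?S\<close> unfolding infl by (auto simp: le_less)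
  qed
qed

end
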